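(* For every nested sequent $\Gamma$, $\Gamma$ is derivable in $\mathbf{SKt}$ if and only if $\Gamma$ is derivable in $\mathbf{DKt}$.
   Context: Formulae are in negation normal form over $a,\neg a,\lor,\land,\square,\blacksquare,\lozenge,\lozenge^{\bullet}$ ($\lozenge^{\bullet}$ the past diamond, dual of $\blacksquare$; $\overline A$ the nnf of the negation of $A$). Nested sequents are multisets of formulae and structures $\circ\{\Gamma\}$, $\bullet\{\Delta\}$; $\Sigma[\,]$ is a context with one hole, which may lie at any depth. $\mathbf{SKt}$ (shallow) has: $id$: $\Gamma,a,\overline a$; $cut$: from $\Gamma,A$ and $\Delta,\overline A$ infer $\Gamma,\Delta$; $\land$: from $\Gamma,A$ and $\Gamma,B$ infer $\Gamma,A\land B$; $\lor$: from $\Gamma,A,B$ infer $\Gamma,A\lor B$; $ctr$: from $\Gamma,\Delta,\Delta$ infer $\Gamma,\Delta$; $wk$: from $\Gamma$ infer $\Gamma,\Delta$; $rf$: from $\Gamma,\circ\{\Delta\}$ infer $\bullet\{\Gamma\},\Delta$; $rp$: from $\Gamma,\bullet\{\Delta\}$ infer $\circ\{\Gamma\},\Delta$; $\blacksquare$: from $\Gamma,\bullet\{A\}$ infer $\Gamma,\blacksquare A$; $\square$: from $\Gamma,\circ\{A\}$ infer $\Gamma,\square A$; $\lozenge^{\bullet}$: from $\Gamma,\bullet\{\Delta,A\}$ infer $\Gamma,\bullet\{\Delta\},\lozenge^{\bullet}A$; $\lozenge$: from $\Gamma,\circ\{\Delta,A\}$ infer $\Gamma,\circ\{\Delta\},\lozenge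 A$. $\mathbf{DKt}$ (deep, no structural rules, no cut) has: $id$: $\Sigma[a,\overline a]$; $\land$: from $\Sigma[A\land B,A]$ and $\Sigma[A\land B,B]$ infer $\Sigma[A\land B]$; $\lor$: from $\Sigma[A\lor B,A,B]$ infer $\Sigma[A\lor B]$; $\blacksquare$: from $\Sigma[\blacksquare A,\bullet\{A\}]$ infer $\Sigma[\blacksquare A]$; $\square$: from $\Sigma[\square A,\circ\{A\}]$ infer $\Sigma[\square A]$; $\lozenge^{\bullet}_1$: from $\Sigma[\bullet\{\Delta,A\},\lozenge^{\bullet}A]$ infer $\Sigma[\bullet\{\Delta\},\lozenge^{\bullet}A]$; $\lozenge^{\bullet}_2$: from $\Sigma[\circ\{\Delta,\lozenge^{\bullet}A\},A]$ infer $\Sigma[\circ\{\Delta,\lozenge^{\bullet}A\}]$; $\lozenge_1$: from $\Sigma[\circ\{\Delta,A\},\lozenge A]$ infer $\Sigma[\circ\{\Delta\},\lozenge A]$; $\lozenge_2$: from $\Sigma[\bullet\{\Delta,\lozenge A\},A]$ infer $\Sigma[\bullet\{\Delta,\lozenge A\}]$. *)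

theory Defs
  imports "HOL-Library.Multiset"
begin

datatype 'p fml =
    Atom 'p
  | NegAtom 'p
  | Or "'p fml" "'p fml"
  | And "'p fml" "'p fml"
  | Box "'p fml"
  | BBox "'p fml"  \<comment> \<open>past box (black)\<close>
  | Dia "'p fml"
  | BDia "'p fml"  \<comment> \<open>past diamond (black)\<close>

primrec dual :: "'p fml \<Rightarrow> 'p fml" where
  "dual (Atom a) = NegAtom a"
| "dual (NegAtom a) = Atom a"
| "dual (Or A B) = And (dual A) (dual B)"
| "dual (And A B) = Or (dual A) (dual B)"
| "dual (Box A) = Dia (dual A)"
| "dual (BBox A) = BDia (dual A)"
| "dual (Dia A) = Box (dual A)"
| "dual (BDia A) = BBox (dual A)"

text \<open>The elements of a nested sequent: \<open>White \<Gamma>\<close> and \<open>Black \<Gamma>\<close> are the structures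
  \<open>\<circ>{\<Gamma>}\<close> and \<open>\<bullet>{\<Gamma>}\<close>. Sequents may be empty, at the root as well as inside a structure.\<close>

datatype 'p item =
    Fml "'p fml"
  | White "'p item multiset"
  | Black "'p item multiset"

type_synonym 'p sequent = "'p item multiset"

text \<open>A context is given by the path to its hole, together with the siblings at every level:
  \<open>CWhite \<Gamma> \<Sigma>\<close> is \<open>\<Gamma>, \<circ>{\<Sigma>[ ]}\<close>.\<close>

datatype 'p ctxt =
    Hole "'p sequent"
  | CWhite "'p sequent" "'p ctxt"
  | CBlack "'p sequent" "'p ctxt"

primrec fill :: "'p ctxt \<Rightarrow> 'p sequent \<Rightarrow> 'p sequent" where
  "fill (Hole \<Gamma>) \<Delta> = \<Gamma> + \<Delta>"
| "fill (CWhite \<Gamma> \<Sigma>) \<Delta> = \<Gamma> + {#White (fill \<Sigma> \<Delta>)#}"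
| "fill (CBlack \<Gamma> \<Sigma>) \<Delta> = \<Gamma> + {#Black (fill \<Sigma> \<Delta>)#}"

inductive SKt :: "'p sequent \<Rightarrow> bool" where
  id: "SKt (\<Gamma> + {#Fml (Atom a), Fml (NegAtom a)#})"
| cut: "SKt (\<Gamma> + {#Fml A#}) \<Longrightarrow> SKt (\<Delta> + {#Fml (dual A)#}) \<Longrightarrow> SKt (\<Gamma> + \<Delta>)"
| conj: "SKt (\<Gamma> + {#Fml A#}) \<Longrightarrow> SKt (\<Gamma> + {#Fml B#}) \<Longrightarrow> SKt (\<Gamma> + {#Fml (And A B)#})"
| disj: "SKt (\<Gamma> + {#Fml A, Fml B#}) \<Longrightarrow> SKt (\<Gamma> + {#Fml (Or A B)#})"
| ctr: "SKt (\<Gamma> + \<Delta> + \<Delta>) \<Longrightarrow> SKt (\<Gamma> + \<Delta>)"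
| wk: "SKt \<Gamma> \<Longrightarrow> SKt (\<Gamma> + \<Delta>)"
| rf: "SKt (\<Gamma> + {#White \<Delta>#}) \<Longrightarrow> SKt ({#Black \<Gamma>#} + \<Delta>)"
| rp: "SKt (\<Gamma> + {#Black \<Delta>#}) \<Longrightarrow> SKt ({#White \<Gamma>#} + \<Delta>)"
| bbox: "SKt (\<Gamma> + {#Black {#Fml A#}#}) \<Longrightarrow> SKt (\<Gamma> + {#Fml (BBox A)#})"
| box: "SKt (\<Gamma> + {#White {#Fml A#}#}) \<Longrightarrow> SKt (\<Gamma> + {#Fml (Box A)#})"
| bdia: "SKt (\<Gamma> + {#Black (\<Delta> + {#Fml A#})#}) \<Longrightarrow> SKt (\<Gamma> + {#Black \<Delta>, Fml (BDia A)#})"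
| dia: "SKt (\<Gamma> + {#White (\<Delta> + {#Fml A#})#}) \<Longrightarrow> SKt (\<Gamma> + {#White \<Delta>, Fml (Dia A)#})"

inductive DKt :: "'p sequent \<Rightarrow> bool" where
  id: "DKt (fill \<Sigma> {#Fml (Atom a), Fml (NegAtom a)#})"
| conj: "DKt (fill \<Sigma> {#Fml (And A B), Fml A#}) \<Longrightarrow> DKt (fill \<Sigma> {#Fml (And A B), Fml B#})
    \<Longrightarrow> DKt (fill \<Sigma> {#Fml (And A B)#})"
| disj: "DKt (fill \<Sigma> {#Fml (Or A B), Fml A, Fml B#}) \<Longrightarrow> DKt (fill \<Sigma> {#Fml (Or A B)#})"
| bbox: "DKt (fill \<Sigma> {#Fml (BBox A), Black {#Fml A#}#}) \<Longrightarrow> DKt (fill \<Sigma> {#Fml (BBox A)#})"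
| box: "DKt (fill \<Sigma> {#Fml (Box A), White {#Fml A#}#}) \<Longrightarrow> DKt (fill \<Sigma> {#Fml (Box A)#})"
| bdia1: "DKt (fill \<Sigma> {#Black (\<Delta> + {#Fml A#}), Fml (BDia A)#})
    \<Longrightarrow> DKt (fill \<Sigma> {#Black \<Delta>, Fml (BDia A)#})"
| bdia2: "DKt (fill \<Sigma> {#White (\<Delta> + {#Fml (BDia A)#}), Fml A#})
    \<Longrightarrow> DKt (fill \<Sigma> {#White (\<Delta> + {#Fml (BDia A)#})#})"
| dia1: "DKt (fill \<Sigma> {#White (\<Delta> + {#Fml A#}), Fml (Dia A)#})
    \<Longrightarrow> DKt (fill \<Sigma> {#White \<Delta>, Fml (Dia A)#})"
| dia2: "DKt (fill \<Sigma> {#Black (\<Delta> + {#Fml (Dia A)#}), Fml A#})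
    \<Longrightarrow> DKt (fill \<Sigma> {#Black (\<Delta> + {#Fml (Dia A)#})#})"

end

theory Submission
  imports Defs
begin

text \<open>Deep rules are simulated in \<open>SKt\<close> by displaying the hole with \<open>rf\<close> and \<open>rp\<close>. The converse is
  semantic: \<open>SKt\<close>, cut included, is sound for tense Kripke models, and \<open>DKt\<close> is complete for them.
  For completeness, rules of \<open>DKt\<close> are read bottom-up: each premise adds something to one node of the
  conclusion. The modal degree of a formula is bounded by a budget that drops by one at each nesting
  level, so adding only what is missing terminates. An underivable sequent to which nothing can be
  added refutes itself in the model whose worlds are its own nodes.\<close>

section \<open>From deep to shallow derivations\<close>

text \<open>\<open>rf\<close> and \<open>rp\<close> undo each other: the converse of either rule is
  an instance of the other with the two sequents exchanged.\<close>

lemma SKt_White_iff: "SKt (\<Gamma> + {#White \<Delta>#}) \<longleftrightarrow> SKt ({#Black \<Gamma>#} + \<Delta>)"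
  using SKt.rf[of \<Gamma> \<Delta>] SKt.rp[of \<Delta> \<Gamma>] by (auto simp: add.commute)

lemma SKt_Black_iff: "SKt (\<Gamma> + {#Black \<Delta>#}) \<longleftrightarrow> SKt ({#White \<Gamma>#} + \<Delta>)"
  using SKt.rp[of \<Gamma> \<Delta>] SKt.rf[of \<Delta> \<Gamma>] by (auto simp: add.commute)

text \<open>Display property. Each level of the context is peeled off by one residuation, which
  packs the siblings collected so far into a structure of the opposite colour;
  \<open>\<Theta>\<close> is general so as to carry them. Choosing \<open>\<Gamma>\<close> before
  \<open>\<Delta>\<close> lets one display serve all premises and the conclusion of a deep
  rule.\<close>

lemma SKt_display: "\<exists>\<Gamma>. \<forall>\<Delta>. SKt (\<Theta> + fill \<Sigma> \<Delta>) \<longleftrightarrow> SKt (\<Gamma> + \<Delta>)"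
proof (induction \<Sigma> arbitrary: \<Theta>)
  case (Hole \<Gamma>)
  show ?case by (rule exI[of _ "\<Theta> + \<Gamma>"]) (simp add: add.assoc)
next
  case (CWhite \<Gamma> \<Sigma>)
  have "SKt (\<Theta> + fill (CWhite \<Gamma> \<Sigma>) \<Delta>) \<longleftrightarrow> SKt ({#Black (\<Theta> + \<Gamma>)#} + fill \<Sigma> \<Delta>)" for \<Delta>
    using SKt_White_iff[of "\<Theta> + \<Gamma>" "fill \<Sigma> \<Delta>"] by (simp add: add.assoc)
  then show ?case using CWhite.IH[of "{#Black (\<Theta> + \<Gamma>)#}"] by (simp only:)
next
  case (CBlack \<Gamma> \<Sigma>)
  have "SKt (\<Theta> + fill (CBlack \<Gamma> \<Sigma>) \<Delta>) \<longleftrightarrow> SKt ({#White (\<Theta> + \<Gamma>)#} + fill \<Sigma> \<Delta>)" for \<Delta>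
    using SKt_Black_iff[of "\<Theta> + \<Gamma>" "fill \<Sigma> \<Delta>"] by (simp add: add.assoc)
  then show ?case using CBlack.IH[of "{#White (\<Theta> + \<Gamma>)#}"] by (simp only:)
qed

lemma SKt_fillE:
  obtains \<Gamma> where "\<And>\<Delta>. SKt (fill \<Sigma> \<Delta>) \<longleftrightarrow> SKt (\<Gamma> + \<Delta>)"
  using SKt_display[of "{#}" \<Sigma>] by auto

lemma SKt_ctr1: "SKt (\<Gamma> + {#x, x#}) \<Longrightarrow> SKt (\<Gamma> + {#x#})"
  using SKt.ctr[of \<Gamma> "{#x#}"] by simp

text \<open>Once the hole is displayed, a deep logical rule is a shallow rule followed by
  contraction, since deep rules keep their principal formula. Only \<open>bdia2\<close> and
  \<open>dia2\<close> need a further change of root.\<close>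

lemma DKt_imp_SKt: "DKt \<Gamma> \<Longrightarrow> SKt \<Gamma>"
proof (induction rule: DKt.induct)
  case (id \<Sigma> a)
  obtain \<Gamma> where \<Gamma>: "\<And>\<Delta>. SKt (fill \<Sigma> \<Delta>) \<longleftrightarrow> SKt (\<Gamma> + \<Delta>)" using SKt_fillE[of \<Sigma>] by blast
  then show ?case using SKt.id by metis
next
  case (conj \<Sigma> A B)
  obtain \<Gamma> where \<Gamma>: "\<And>\<Delta>. SKt (fill \<Sigma> \<Delta>) \<longleftrightarrow> SKt (\<Gamma> + \<Delta>)" using SKt_fillE[of \<Sigma>] by blast
  have "SKt (\<Gamma> + {#Fml (And A B)#} + {#Fml A#})" "SKt (\<Gamma> + {#Fml (And A B)#} + {#Fml B#})"
    using conj.IH unfolding \<Gamma> by (simp_all add: add_mset_commute)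
  from SKt.conj[OF this] show ?case
    unfolding \<Gamma> by (intro SKt_ctr1) simp
next
  case (disj \<Sigma> A B)
  obtain \<Gamma> where \<Gamma>: "\<And>\<Delta>. SKt (fill \<Sigma> \<Delta>) \<longleftrightarrow> SKt (\<Gamma> + \<Delta>)" using SKt_fillE[of \<Sigma>] by blast
  have "SKt (\<Gamma> + {#Fml (Or A B)#} + {#Fml A, Fml B#})"
    using disj.IH unfolding \<Gamma> by (simp add: add_mset_commute)
  from SKt.disj[OF this] show ?case
    unfolding \<Gamma> by (intro SKt_ctr1) simp
next
  case (bbox \<Sigma> A)
  obtain \<Gamma> where \<Gamma>: "\<And>\<Delta>. SKt (fill \<Sigma> \<Delta>) \<longleftrightarrow> SKt (\<Gamma> + \<Delta>)" using SKt_fillE[of \<Sigma>] by blast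
  have "SKt (\<Gamma> + {#Fml (BBox A)#} + {#Black {#Fml A#}#})"
    using bbox.IH unfolding \<Gamma> by (simp add: add_mset_commute)
  from SKt.bbox[OF this] show ?case
    unfolding \<Gamma> by (intro SKt_ctr1) simp
next
  case (box \<Sigma> A)
  obtain \<Gamma> where \<Gamma>: "\<And>\<Delta>. SKt (fill \<Sigma> \<Delta>) \<longleftrightarrow> SKt (\<Gamma> + \<Delta>)" using SKt_fillE[of \<Sigma>] by blast
  have "SKt (\<Gamma> + {#Fml (Box A)#} + {#White {#Fml A#}#})"
    using box.IH unfolding \<Gamma> by (simp add: add_mset_commute)
  from SKt.box[OF this] show ?case
    unfolding \<Gamma> by (intro SKt_ctr1) simp
next
  case (bdia1 \<Sigma> \<Delta> A)
  obtain \<Gamma> where \<Gamma>: "\<And>\<Delta>. SKt (fill \<Sigma> \<Delta>) \<longleftrightarrow> SKt (\<Gamma> + \<Delta>)" using SKt_fillE[of \<Sigma>] by blast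
  have "SKt (\<Gamma> + {#Fml (BDia A)#} + {#Black (\<Delta> + {#Fml A#})#})"
    using bdia1.IH unfolding \<Gamma> by (simp add: add_mset_commute)
  from SKt.bdia[OF this] show ?case
    unfolding \<Gamma> using SKt_ctr1[of "\<Gamma> + {#Black \<Delta>#}" "Fml (BDia A)"] by (simp add: add_mset_commute)
next
  case (dia1 \<Sigma> \<Delta> A)
  obtain \<Gamma> where \<Gamma>: "\<And>\<Delta>. SKt (fill \<Sigma> \<Delta>) \<longleftrightarrow> SKt (\<Gamma> + \<Delta>)" using SKt_fillE[of \<Sigma>] by blast
  have "SKt (\<Gamma> + {#Fml (Dia A)#} + {#White (\<Delta> + {#Fml A#})#})"
    using dia1.IH unfolding \<Gamma> by (simp add: add_mset_commute)
  from SKt.dia[OF this] show ?case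
    unfolding \<Gamma> using SKt_ctr1[of "\<Gamma> + {#White \<Delta>#}" "Fml (Dia A)"] by (simp add: add_mset_commute)
next
  case (bdia2 \<Sigma> \<Delta> A)
  obtain \<Gamma> where \<Gamma>: "\<And>\<Delta>. SKt (fill \<Sigma> \<Delta>) \<longleftrightarrow> SKt (\<Gamma> + \<Delta>)" using SKt_fillE[of \<Sigma>] by blast
  have "SKt (\<Gamma> + {#Fml A#} + {#White (\<Delta> + {#Fml (BDia A)#})#})"
    using bdia2.IH unfolding \<Gamma> by (simp add: add_mset_commute)
  \<comment> \<open>Residuation makes the child the root and the former root a black child. Moving
    \<open>A\<close> outward thereby becomes the shallow \<open>bdia\<close> rule acting on that
    child; a second residuation restores the old root.\<close>
  then have "SKt (\<Delta> + {#Fml (BDia A)#} + {#Black (\<Gamma> + {#Fml A#})#})"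
    unfolding SKt_White_iff by (simp add: add_mset_commute)
  from SKt.bdia[OF this] have "SKt ({#Black \<Gamma>#} + (\<Delta> + {#Fml (BDia A)#}))"
    using SKt_ctr1[of "\<Delta> + {#Black \<Gamma>#}" "Fml (BDia A)"] by (simp add: add_mset_commute)
  then show ?case unfolding \<Gamma> SKt_White_iff .
next
  case (dia2 \<Sigma> \<Delta> A)
  obtain \<Gamma> where \<Gamma>: "\<And>\<Delta>. SKt (fill \<Sigma> \<Delta>) \<longleftrightarrow> SKt (\<Gamma> + \<Delta>)" using SKt_fillE[of \<Sigma>] by blast
  have "SKt (\<Gamma> + {#Fml A#} + {#Black (\<Delta> + {#Fml (Dia A)#})#})"
    using dia2.IH unfolding \<Gamma> by (simp add: add_mset_commute)
  then have "SKt (\<Delta> + {#Fml (Dia A)#} + {#White (\<Gamma> + {#Fml A#})#})"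
    unfolding SKt_Black_iff by (simp add: add_mset_commute)
  from SKt.dia[OF this] have "SKt ({#White \<Gamma>#} + (\<Delta> + {#Fml (Dia A)#}))"
    using SKt_ctr1[of "\<Delta> + {#White \<Gamma>#}" "Fml (Dia A)"] by (simp add: add_mset_commute)
  then show ?case unfolding \<Gamma> SKt_Black_iff .
qed

section \<open>Kripke semantics and soundness of the shallow calculus\<close>

context
  fixes R :: "'w \<Rightarrow> 'w \<Rightarrow> bool" and V :: "'w \<Rightarrow> 'p \<Rightarrow> bool"
begin

primrec holds :: "'p fml \<Rightarrow> 'w \<Rightarrow> bool" where
  "holds (Atom a) w \<longleftrightarrow> V w a"
| "holds (NegAtom a) w \<longleftrightarrow> \<not> V w a"
| "holds (Or A B) w \<longleftrightarrow> holds A w \<or> holds B w"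
| "holds (And A B) w \<longleftrightarrow> holds A w \<and> holds B w"
| "holds (Box A) w \<longleftrightarrow> (\<forall>v. R w v \<longrightarrow> holds A v)"
| "holds (BBox A) w \<longleftrightarrow> (\<forall>v. R v w \<longrightarrow> holds A v)"
| "holds (Dia A) w \<longleftrightarrow> (\<exists>v. R w v \<and> holds A v)"
| "holds (BDia A) w \<longleftrightarrow> (\<exists>v. R v w \<and> holds A v)"

text \<open>A white structure acts as a box over the disjunction of its items, a black one as a past
  box. The truth functions of the items are collected with \<open>image_mset\<close> because the
  recursion passes through a nested multiset.\<close>

primrec holds_item :: "'p item \<Rightarrow> 'w \<Rightarrow> bool" where
  "holds_item (Fml A) = holds A"
| "holds_item (White \<Gamma>) = (\<lambda>w. \<forall>v. R w v \<longrightarrow> (\<exists>h \<in># image_mset holds_item \<Gamma>. h v))"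
| "holds_item (Black \<Gamma>) = (\<lambda>w. \<forall>v. R v w \<longrightarrow> (\<exists>h \<in># image_mset holds_item \<Gamma>. h v))"

definition holds_seq :: "'p sequent \<Rightarrow> 'w \<Rightarrow> bool" where
  "holds_seq \<Gamma> w \<longleftrightarrow> (\<exists>x \<in># \<Gamma>. holds_item x w)"

lemma holds_item_White [simp]: "holds_item (White \<Gamma>) w \<longleftrightarrow> (\<forall>v. R w v \<longrightarrow> holds_seq \<Gamma> v)"
  and holds_item_Black [simp]: "holds_item (Black \<Gamma>) w \<longleftrightarrow> (\<forall>v. R v w \<longrightarrow> holds_seq \<Gamma> v)"
  by (auto simp: holds_seq_def)

declare holds_item.simps(2,3) [simp del]

lemma holds_seq_simps [simp]:
  "\<not> holds_seq {#} w"
  "holds_seq (add_mset x \<Gamma>) w \<longleftrightarrow> holds_item x w \<or> holds_seq \<Gamma> w"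
  "holds_seq (\<Gamma> + \<Delta>) w \<longleftrightarrow> holds_seq \<Gamma> w \<or> holds_seq \<Delta> w"
  by (auto simp: holds_seq_def)

lemma holds_dual [simp]: "holds (dual A) w \<longleftrightarrow> \<not> holds A w"
  by (induction A arbitrary: w) auto

text \<open>The rules preserve truth at all worlds of a model, not at a single one, hence the
  arbitrary \<open>w\<close>. For \<open>rf\<close>: at a predecessor of \<open>w\<close> where
  \<open>\<Gamma>\<close> fails, \<open>White \<Delta>\<close> must hold, so \<open>\<Delta>\<close>
  holds at \<open>w\<close>; \<open>rp\<close> is the mirror image along successors.\<close>

lemma SKt_sound: "SKt \<Gamma> \<Longrightarrow> holds_seq \<Gamma> w"
proof (induction arbitrary: w rule: SKt.induct)
  case (rf \<Gamma> \<Delta>)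
  then show ?case by simp blast
next
  case (rp \<Gamma> \<Delta>)
  then show ?case by simp blast
next
  case (cut \<Gamma> A \<Delta>)
  then show ?case by simp blast
next
  case (bdia \<Gamma> \<Delta> A)
  then show ?case by simp blast
next
  case (dia \<Gamma> \<Delta> A)
  then show ?case by simp blast
qed auto

end

section \<open>Deep rules as additions to a node\<close>

text \<open>The argument is the entire content of one node, whereas the hole of a
  \<open>ctxt\<close> has siblings. Adding \<open>X\<close> to a node with content
  \<open>\<Delta>\<close> is then the passage from \<open>F \<Delta>\<close> to
  \<open>F (\<Delta> + X)\<close>.\<close>

inductive node_ctxt :: "('p sequent \<Rightarrow> 'p sequent) \<Rightarrow> bool" where
  root: "node_ctxt (\<lambda>X. X)"
| white: "node_ctxt F \<Longrightarrow> node_ctxt (\<lambda>X. add_mset (White (F X)) \<Gamma>)"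
| black: "node_ctxt F \<Longrightarrow> node_ctxt (\<lambda>X. add_mset (Black (F X)) \<Gamma>)"

text \<open>The introduction rules grow a context at the root; here it grows at the hole, which is
  how one descends from a node to its child.\<close>

lemma node_ctxt_White: "node_ctxt F \<Longrightarrow> node_ctxt (\<lambda>X. F (add_mset (White X) \<Gamma>))"
  and node_ctxt_Black: "node_ctxt F \<Longrightarrow> node_ctxt (\<lambda>X. F (add_mset (Black X) \<Gamma>))"
  by (induction rule: node_ctxt.induct) (auto intro: node_ctxt.intros)

text \<open>The part \<open>\<Gamma>\<close> of the node that a rule leaves alone becomes the
  content of \<open>Hole\<close>. As \<open>\<Sigma>\<close> is independent of \<open>X\<close>,
  premises and conclusion share one context.\<close>

lemma node_ctxt_fill: "node_ctxt F \<Longrightarrow> \<exists>\<Sigma>. \<forall>X. F (\<Gamma> + X) = fill \<Sigma> X"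
proof (induction rule: node_ctxt.induct)
  case root
  show ?case by (rule exI[of _ "Hole \<Gamma>"]) simp
next
  case (white F \<Delta>)
  then obtain \<Sigma> where "\<forall>X. F (\<Gamma> + X) = fill \<Sigma> X" by blast
  then show ?case by (intro exI[of _ "CWhite \<Delta> \<Sigma>"]) simp
next
  case (black F \<Delta>)
  then obtain \<Sigma> where "\<forall>X. F (\<Gamma> + X) = fill \<Sigma> X" by blast
  then show ?case by (intro exI[of _ "CBlack \<Delta> \<Sigma>"]) simp
qed

text \<open>Every node sits in a positive position. With \<open>\<Delta>'\<close> a larger node, a
  model refuting a premise also refutes the conclusion.\<close>

lemma node_ctxt_holds_mono:
  assumes "node_ctxt F" and "\<And>w. holds_seq R V \<Delta> w \<Longrightarrow> holds_seq R V \<Delta>' w"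
  shows "holds_seq R V (F \<Delta>) w \<Longrightarrow> holds_seq R V (F \<Delta>') w"
  using assms(1) by (induction arbitrary: w rule: node_ctxt.induct) (auto intro: assms(2))

context
  fixes F :: "'p sequent \<Rightarrow> 'p sequent"
  assumes F: "node_ctxt F"
begin

lemma DKt_node_id: "Fml (Atom a) \<in># \<Delta> \<Longrightarrow> Fml (NegAtom a) \<in># \<Delta> \<Longrightarrow> DKt (F \<Delta>)"
proof -
  assume "Fml (Atom a) \<in># \<Delta>" "Fml (NegAtom a) \<in># \<Delta>"
  then obtain \<Gamma>' where "\<Delta> = add_mset (Fml (Atom a)) \<Gamma>'" "Fml (NegAtom a) \<in># \<Gamma>'"
    by (auto dest!: multi_member_split[of "Fml (Atom a)"])
  then obtain \<Gamma> where \<Delta>: "\<Delta> = \<Gamma> + {#Fml (Atom a), Fml (NegAtom a)#}"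
    by (auto dest!: multi_member_split)
  obtain \<Sigma> where "\<forall>X. F (\<Gamma> + X) = fill \<Sigma> X" using node_ctxt_fill[OF F] by blast
  then show ?thesis unfolding \<Delta> by (simp only: DKt.id)
qed

lemma DKt_node_conj:
  assumes "Fml (And A B) \<in># \<Delta>" "DKt (F (\<Delta> + {#Fml A#}))" "DKt (F (\<Delta> + {#Fml B#}))"
  shows "DKt (F \<Delta>)"
proof -
  obtain \<Gamma> where \<Delta>: "\<Delta> = \<Gamma> + {#Fml (And A B)#}"
    using assms(1) by (auto dest!: multi_member_split)
  obtain \<Sigma> where \<Sigma>: "\<forall>X. F (\<Gamma> + X) = fill \<Sigma> X" using node_ctxt_fill[OF F] by blast
  show ?thesis using assms(2,3) DKt.conj[of \<Sigma> A B] unfolding \<Delta> add.assoc \<Sigma>[rule_format]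
    by (simp add: add_mset_commute)
qed

lemma DKt_node_disj:
  assumes "Fml (Or A B) \<in># \<Delta>" "DKt (F (\<Delta> + {#Fml A, Fml B#}))"
  shows "DKt (F \<Delta>)"
proof -
  obtain \<Gamma> where \<Delta>: "\<Delta> = \<Gamma> + {#Fml (Or A B)#}"
    using assms(1) by (auto dest!: multi_member_split)
  obtain \<Sigma> where \<Sigma>: "\<forall>X. F (\<Gamma> + X) = fill \<Sigma> X" using node_ctxt_fill[OF F] by blast
  show ?thesis using assms(2) DKt.disj[of \<Sigma> A B] unfolding \<Delta> add.assoc \<Sigma>[rule_format]
    by (simp add: add_mset_commute)
qed

lemma DKt_node_box:
  assumes "Fml (Box A) \<in># \<Delta>" "DKt (F (\<Delta> + {#White {#Fml A#}#}))"
  shows "DKt (F \<Delta>)"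
proof -
  obtain \<Gamma> where \<Delta>: "\<Delta> = \<Gamma> + {#Fml (Box A)#}"
    using assms(1) by (auto dest!: multi_member_split)
  obtain \<Sigma> where \<Sigma>: "\<forall>X. F (\<Gamma> + X) = fill \<Sigma> X" using node_ctxt_fill[OF F] by blast
  show ?thesis using assms(2) DKt.box[of \<Sigma> A] unfolding \<Delta> add.assoc \<Sigma>[rule_format]
    by (simp add: add_mset_commute)
qed

lemma DKt_node_bbox:
  assumes "Fml (BBox A) \<in># \<Delta>" "DKt (F (\<Delta> + {#Black {#Fml A#}#}))"
  shows "DKt (F \<Delta>)"
proof -
  obtain \<Gamma> where \<Delta>: "\<Delta> = \<Gamma> + {#Fml (BBox A)#}"
    using assms(1) by (auto dest!: multi_member_split)
  obtain \<Sigma> where \<Sigma>: "\<forall>X. F (\<Gamma> + X) = fill \<Sigma> X" using node_ctxt_fill[OF F] by blast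
  show ?thesis using assms(2) DKt.bbox[of \<Sigma> A] unfolding \<Delta> add.assoc \<Sigma>[rule_format]
    by (simp add: add_mset_commute)
qed

text \<open>Here the addition goes to a child while the principal formula stays among the siblings
  \<open>\<Gamma>\<close> in the parent, so both levels are spelled out.\<close>

lemma DKt_node_dia1:
  assumes "Fml (Dia A) \<in># \<Gamma>" "DKt (F (add_mset (White (\<Theta> + {#Fml A#})) \<Gamma>))"
  shows "DKt (F (add_mset (White \<Theta>) \<Gamma>))"
proof -
  obtain \<Gamma>' where \<Gamma>: "\<Gamma> = \<Gamma>' + {#Fml (Dia A)#}"
    using assms(1) by (auto dest!: multi_member_split)
  obtain \<Sigma> where \<Sigma>: "\<forall>X. F (\<Gamma>' + X) = fill \<Sigma> X" using node_ctxt_fill[OF F] by blast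
  have eq: "add_mset (White X) \<Gamma> = \<Gamma>' + {#White X, Fml (Dia A)#}" for X by (simp add: \<Gamma>)
  show ?thesis using assms(2) DKt.dia1[of \<Sigma> \<Theta> A] unfolding eq \<Sigma>[rule_format] by blast
qed

lemma DKt_node_bdia1:
  assumes "Fml (BDia A) \<in># \<Gamma>" "DKt (F (add_mset (Black (\<Theta> + {#Fml A#})) \<Gamma>))"
  shows "DKt (F (add_mset (Black \<Theta>) \<Gamma>))"
proof -
  obtain \<Gamma>' where \<Gamma>: "\<Gamma> = \<Gamma>' + {#Fml (BDia A)#}"
    using assms(1) by (auto dest!: multi_member_split)
  obtain \<Sigma> where \<Sigma>: "\<forall>X. F (\<Gamma>' + X) = fill \<Sigma> X" using node_ctxt_fill[OF F] by blast
  have eq: "add_mset (Black X) \<Gamma> = \<Gamma>' + {#Black X, Fml (BDia A)#}" for X by (simp add: \<Gamma>)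
  show ?thesis using assms(2) DKt.bdia1[of \<Sigma> \<Theta> A] unfolding eq \<Sigma>[rule_format] by blast
qed

lemma DKt_node_dia2:
  assumes "Black \<Theta> \<in># \<Delta>" "Fml (Dia A) \<in># \<Theta>" "DKt (F (\<Delta> + {#Fml A#}))"
  shows "DKt (F \<Delta>)"
proof -
  obtain \<Theta>' where \<Theta>: "\<Theta> = \<Theta>' + {#Fml (Dia A)#}"
    using assms(2) by (auto dest!: multi_member_split)
  obtain \<Gamma> where \<Delta>: "\<Delta> = \<Gamma> + {#Black (\<Theta>' + {#Fml (Dia A)#})#}"
    using assms(1) unfolding \<Theta> by (auto dest!: multi_member_split)
  obtain \<Sigma> where \<Sigma>: "\<forall>X. F (\<Gamma> + X) = fill \<Sigma> X" using node_ctxt_fill[OF F] by blast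
  show ?thesis using assms(3) DKt.dia2[of \<Sigma> \<Theta>' A] unfolding \<Delta> add.assoc \<Sigma>[rule_format]
    by (simp add: add_mset_commute)
qed

lemma DKt_node_bdia2:
  assumes "White \<Theta> \<in># \<Delta>" "Fml (BDia A) \<in># \<Theta>" "DKt (F (\<Delta> + {#Fml A#}))"
  shows "DKt (F \<Delta>)"
proof -
  obtain \<Theta>' where \<Theta>: "\<Theta> = \<Theta>' + {#Fml (BDia A)#}"
    using assms(2) by (auto dest!: multi_member_split)
  obtain \<Gamma> where \<Delta>: "\<Delta> = \<Gamma> + {#White (\<Theta>' + {#Fml (BDia A)#})#}"
    using assms(1) unfolding \<Theta> by (auto dest!: multi_member_split)
  obtain \<Sigma> where \<Sigma>: "\<forall>X. F (\<Gamma> + X) = fill \<Sigma> X" using node_ctxt_fill[OF F] by blast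
  show ?thesis using assms(3) DKt.bdia2[of \<Sigma> \<Theta>' A] unfolding \<Delta> add.assoc \<Sigma>[rule_format]
    by (simp add: add_mset_commute)
qed

end

section \<open>Termination of saturation\<close>

primrec degree :: "'p fml \<Rightarrow> nat" where
  "degree (Atom a) = 0"
| "degree (NegAtom a) = 0"
| "degree (Or A B) = max (degree A) (degree B)"
| "degree (And A B) = max (degree A) (degree B)"
| "degree (Box A) = Suc (degree A)"
| "degree (BBox A) = Suc (degree A)"
| "degree (Dia A) = Suc (degree A)"
| "degree (BDia A) = Suc (degree A)"

primrec subfmls :: "'p fml \<Rightarrow> 'p fml set" where
  "subfmls (Atom a) = {Atom a}"
| "subfmls (NegAtom a) = {NegAtom a}"
| "subfmls (Or A B) = insert (Or A B) (subfmls A \<union> subfmls B)"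
| "subfmls (And A B) = insert (And A B) (subfmls A \<union> subfmls B)"
| "subfmls (Box A) = insert (Box A) (subfmls A)"
| "subfmls (BBox A) = insert (BBox A) (subfmls A)"
| "subfmls (Dia A) = insert (Dia A) (subfmls A)"
| "subfmls (BDia A) = insert (BDia A) (subfmls A)"

lemma finite_subfmls [simp]: "finite (subfmls A)"
  by (induction A) auto

lemma subfmls_refl [simp]: "A \<in> subfmls A"
  by (cases A) auto

lemma subfmls_trans: "A \<in> subfmls B \<Longrightarrow> subfmls A \<subseteq> subfmls B"
  by (induction B) auto

text \<open>No rule breaks this bound when read bottom-up: a formula sent into a child loses a
  modality together with the level, and a formula sent to the parent only gets smaller while the
  budget grows. Nesting depth therefore never exceeds the budget of the root.\<close>

primrec bounded :: "'p fml set \<Rightarrow> nat \<Rightarrow> 'p sequent \<Rightarrow> bool" where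
  "bounded S 0 \<Gamma> \<longleftrightarrow> (\<forall>x \<in># \<Gamma>. case x of
      Fml A \<Rightarrow> A \<in> S \<and> degree A = 0 | White \<Delta> \<Rightarrow> False | Black \<Delta> \<Rightarrow> False)"
| "bounded S (Suc k) \<Gamma> \<longleftrightarrow> (\<forall>x \<in># \<Gamma>. case x of
      Fml A \<Rightarrow> A \<in> S \<and> degree A \<le> Suc k | White \<Delta> \<Rightarrow> bounded S k \<Delta> | Black \<Delta> \<Rightarrow> bounded S k \<Delta>)"

lemma bounded_empty [simp]: "bounded S k {#}"
  by (cases k) auto

lemma bounded_union [simp]: "bounded S k (\<Gamma> + \<Delta>) \<longleftrightarrow> bounded S k \<Gamma> \<and> bounded S k \<Delta>"
  by (cases k) auto

lemma bounded_add_Fml [simp]: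
  "bounded S k (add_mset (Fml A) \<Gamma>) \<longleftrightarrow> A \<in> S \<and> degree A \<le> k \<and> bounded S k \<Gamma>"
  by (cases k) auto

lemma bounded_add_White:
  "bounded S k (add_mset (White \<Delta>) \<Gamma>) \<longleftrightarrow> (\<exists>j. k = Suc j \<and> bounded S j \<Delta>) \<and> bounded S k \<Gamma>"
  by (cases k) auto

lemma bounded_add_Black:
  "bounded S k (add_mset (Black \<Delta>) \<Gamma>) \<longleftrightarrow> (\<exists>j. k = Suc j \<and> bounded S j \<Delta>) \<and> bounded S k \<Gamma>"
  by (cases k) auto

lemma bounded_FmlD: "bounded S k \<Gamma> \<Longrightarrow> Fml A \<in># \<Gamma> \<Longrightarrow> A \<in> S \<and> degree A \<le> k"
  by (auto dest!: multi_member_split)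

text \<open>Asking for every larger \<open>S'\<close> and \<open>k'\<close> makes the bounds of
  finitely many items combine, by union and maximum; \<open>seq\<close> does this for a whole
  multiset inside the induction over items.\<close>

lemma ex_bounded_item:
  "\<exists>S k. finite S \<and> (\<forall>S' k'. S \<subseteq> S' \<longrightarrow> k \<le> k' \<longrightarrow> bounded S' k' {#x#})"
proof -
  have seq: "\<exists>S k. finite S \<and> (\<forall>S' k'. S \<subseteq> S' \<longrightarrow> k \<le> k' \<longrightarrow> bounded S' k' \<Gamma>)"
    if "\<And>x. x \<in># \<Gamma> \<Longrightarrow> \<exists>S k. finite S \<and> (\<forall>S' k'. S \<subseteq> S' \<longrightarrow> k \<le> k' \<longrightarrow> bounded S' k' {#x#})"
    for \<Gamma> :: "'a sequent"
    using that
  proof (induction \<Gamma>)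
    case empty
    then show ?case by (auto intro: exI[of _ "{}"])
  next
    case (add x \<Gamma>)
    then obtain S k where 1: "finite S" "\<forall>S' k'. S \<subseteq> S' \<longrightarrow> k \<le> k' \<longrightarrow> bounded S' k' \<Gamma>"
      by auto
    obtain T l where 2: "finite T" "\<forall>S' k'. T \<subseteq> S' \<longrightarrow> l \<le> k' \<longrightarrow> bounded S' k' {#x#}"
      using add.prems[of x] by auto
    have "bounded S' k' (add_mset x \<Gamma>)" if "S \<union> T \<subseteq> S'" "max k l \<le> k'" for S' k'
      using 1(2) 2(2) that bounded_union[of S' k' "{#x#}" \<Gamma>] by simp
    then show ?case using 1(1) 2(1) by (intro exI[of _ "S \<union> T"] exI[of _ "max k l"]) simp
  qed
  show ?thesis
  proof (induction x)
    case (Fml A)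
    show ?case by (intro exI[of _ "{A}"] exI[of _ "degree A"]) auto
  next
    case (White \<Gamma>)
    then obtain S k where "finite S" "\<forall>S' k'. S \<subseteq> S' \<longrightarrow> k \<le> k' \<longrightarrow> bounded S' k' \<Gamma>"
      using seq by metis
    moreover from this have "bounded S' k' {#White \<Gamma>#}" if "S \<subseteq> S'" "Suc k \<le> k'" for S' k'
      using that by (cases k') (auto simp: bounded_add_White)
    ultimately show ?case by blast
  next
    case (Black \<Gamma>)
    then obtain S k where "finite S" "\<forall>S' k'. S \<subseteq> S' \<longrightarrow> k \<le> k' \<longrightarrow> bounded S' k' \<Gamma>"
      using seq by metis
    moreover from this have "bounded S' k' {#Black \<Gamma>#}" if "S \<subseteq> S'" "Suc k \<le> k'" for S' k'
      using that by (cases k') (auto simp: bounded_add_Black)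
    ultimately show ?case by blast
  qed
qed

lemma ex_bounded: obtains S k where "finite S" "\<And>A. A \<in> S \<Longrightarrow> subfmls A \<subseteq> S" "bounded S k \<Gamma>"
proof -
  \<comment> \<open>The sequent is wrapped into one structure to reuse the lemma on items; a budget
    of \<open>Suc k\<close> for the structure leaves \<open>k\<close> for its content.\<close>
  obtain S k where S: "finite S" "\<And>S'. S \<subseteq> S' \<Longrightarrow> bounded S' (Suc k) {#White \<Gamma>#}"
    using ex_bounded_item[of "White \<Gamma>"] by (metis le_Suc_eq order_refl)
  define U where "U = (\<Union>A\<in>S. subfmls A)"
  have "S \<subseteq> U" using subfmls_refl unfolding U_def by blast
  with S(2) have "bounded U k \<Gamma>" by (simp add: bounded_add_White)
  moreover have "subfmls A \<subseteq> U" if "A \<in> U" for A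
    using that subfmls_trans unfolding U_def by blast
  moreover have "finite U" using S(1) by (simp add: U_def)
  ultimately show thesis by (intro that)
qed

text \<open>A missing child weighs more than the measure of the child that is created for it,
  which is at most that of the empty sequent.\<close>

primrec missing :: "'p fml set \<Rightarrow> nat \<Rightarrow> 'p sequent \<Rightarrow> nat" where
  "missing S 0 \<Gamma> = card {A \<in> S. Fml A \<notin># \<Gamma>}"
| "missing S (Suc k) \<Gamma> = card {A \<in> S. Fml A \<notin># \<Gamma>}
    + (\<Sum>x\<in>#\<Gamma>. case x of Fml A \<Rightarrow> 0 | White \<Delta> \<Rightarrow> missing S k \<Delta> | Black \<Delta> \<Rightarrow> missing S k \<Delta>)
    + (card {A \<in> S. \<forall>\<Delta>. White \<Delta> \<in># \<Gamma> \<longrightarrow> Fml A \<notin># \<Delta>}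
      + card {A \<in> S. \<forall>\<Delta>. Black \<Delta> \<in># \<Gamma> \<longrightarrow> Fml A \<notin># \<Delta>}) * Suc (missing S k {#})"

text \<open>The clause that formulae are kept matters one level up: it prevents the parent's count
  of absent children from growing when a child is extended.\<close>

definition extends :: "'p fml set \<Rightarrow> nat \<Rightarrow> 'p sequent \<Rightarrow> 'p sequent \<Rightarrow> bool" where
  "extends S k \<Gamma> \<Gamma>' \<longleftrightarrow> bounded S k \<Gamma>' \<and> (\<forall>A. Fml A \<in># \<Gamma> \<longrightarrow> Fml A \<in># \<Gamma>') \<and> missing S k \<Gamma>' < missing S k \<Gamma>"

section \<open>Additions that decrease the measure\<close>

context
  fixes S :: "'p fml set"
  assumes S: "finite S"
begin

text \<open>A multiset \<open>N\<close> is added because a disjunction contributes both disjuncts at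
  once, and one new formula among them suffices. Children and the counts of absent children stay as
  they were.\<close>

lemma extends_add_fmls:
  assumes "bounded S k \<Gamma>" "set_mset N \<subseteq> S" "\<And>A. A \<in># N \<Longrightarrow> degree A \<le> k"
    and "A \<in># N" "Fml A \<notin># \<Gamma>"
  shows "extends S k \<Gamma> (\<Gamma> + image_mset Fml N)"
proof -
  have "bounded S k (image_mset Fml N)" using assms(2,3)
    by (induction N) auto
  moreover have "card {A \<in> S. Fml A \<notin># \<Gamma> + image_mset Fml N} < card {A \<in> S. Fml A \<notin># \<Gamma>}"
    using assms S by (intro psubset_card_mono) auto
  moreover have "White \<Delta> \<in># \<Gamma> + image_mset Fml N \<longleftrightarrow> White \<Delta> \<in># \<Gamma>"
    "Black \<Delta> \<in># \<Gamma> + image_mset Fml N \<longleftrightarrow> Black \<Delta> \<in># \<Gamma>" for \<Delta> by auto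
  ultimately show ?thesis using assms(1)
    unfolding extends_def by (cases k) (simp_all add: image_mset.compositionality comp_def del: union_iff)
qed

lemma extends_add_Fml:
  assumes "bounded S k \<Gamma>" "A \<in> S" "degree A \<le> k" "Fml A \<notin># \<Gamma>"
  shows "extends S k \<Gamma> (\<Gamma> + {#Fml A#})"
  using extends_add_fmls[of k \<Gamma> "{#A#}" A] assms by simp

lemma missing_singleton_le:
  assumes "A \<in> S" "degree A \<le> k"
  shows "missing S k {#Fml A#} \<le> missing S k {#}"
  using extends_add_Fml[of k "{#}" A] assms by (simp add: extends_def)

lemma extends_add_White:
  assumes "bounded S (Suc k) \<Gamma>" "A \<in> S" "degree A \<le> k" "\<And>\<Delta>. White \<Delta> \<in># \<Gamma> \<Longrightarrow> Fml A \<notin># \<Delta>"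
  shows "extends S (Suc k) \<Gamma> (\<Gamma> + {#White {#Fml A#}#})"
proof -
  let ?M = "\<lambda>\<Gamma>. {A \<in> S. \<forall>\<Delta>. White \<Delta> \<in># \<Gamma> \<longrightarrow> Fml A \<notin># \<Delta>}"
  have "card (?M (\<Gamma> + {#White {#Fml A#}#})) < card (?M \<Gamma>)"
    using assms S by (intro psubset_card_mono) auto
  \<comment> \<open>One unit of weight \<open>Suc (missing S k {#})\<close> is released, while the
    new child costs at most \<open>missing S k {#}\<close>; the \<open>Suc\<close> makes the
    decrease strict.\<close>
  then have "Suc (card (?M (\<Gamma> + {#White {#Fml A#}#}))) * Suc (missing S k {#})
      \<le> card (?M \<Gamma>) * Suc (missing S k {#})"
    by (intro mult_le_mono1) simp
  then show ?thesis using assms missing_singleton_le[OF assms(2,3)]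
    by (simp add: extends_def bounded_add_White algebra_simps)
qed

lemma extends_add_Black:
  assumes "bounded S (Suc k) \<Gamma>" "A \<in> S" "degree A \<le> k" "\<And>\<Delta>. Black \<Delta> \<in># \<Gamma> \<Longrightarrow> Fml A \<notin># \<Delta>"
  shows "extends S (Suc k) \<Gamma> (\<Gamma> + {#Black {#Fml A#}#})"
proof -
  let ?M = "\<lambda>\<Gamma>. {A \<in> S. \<forall>\<Delta>. Black \<Delta> \<in># \<Gamma> \<longrightarrow> Fml A \<notin># \<Delta>}"
  have "card (?M (\<Gamma> + {#Black {#Fml A#}#})) < card (?M \<Gamma>)"
    using assms S by (intro psubset_card_mono) auto
  then have "Suc (card (?M (\<Gamma> + {#Black {#Fml A#}#}))) * Suc (missing S k {#})
      \<le> card (?M \<Gamma>) * Suc (missing S k {#})"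
    by (intro mult_le_mono1) simp
  then show ?thesis using assms missing_singleton_le[OF assms(2,3)]
    by (simp add: extends_def bounded_add_Black algebra_simps)
qed

lemma extends_White:
  assumes "bounded S (Suc k) \<Gamma>" "extends S k \<Delta> \<Delta>'"
  shows "extends S (Suc k) (add_mset (White \<Delta>) \<Gamma>) (add_mset (White \<Delta>') \<Gamma>)"
proof -
  let ?M = "\<lambda>\<Gamma>. {A \<in> S. \<forall>\<Delta>. White \<Delta> \<in># \<Gamma> \<longrightarrow> Fml A \<notin># \<Delta>}"
  have "card (?M (add_mset (White \<Delta>') \<Gamma>)) \<le> card (?M (add_mset (White \<Delta>) \<Gamma>))"
    using assms S by (intro card_mono) (auto simp: extends_def)
  then have "card (?M (add_mset (White \<Delta>') \<Gamma>)) * Suc (missing S k {#})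
      \<le> card (?M (add_mset (White \<Delta>) \<Gamma>)) * Suc (missing S k {#})"
    by (rule mult_le_mono1)
  then show ?thesis using assms
    by (simp add: extends_def bounded_add_White algebra_simps)
qed

lemma extends_Black:
  assumes "bounded S (Suc k) \<Gamma>" "extends S k \<Delta> \<Delta>'"
  shows "extends S (Suc k) (add_mset (Black \<Delta>) \<Gamma>) (add_mset (Black \<Delta>') \<Gamma>)"
proof -
  let ?M = "\<lambda>\<Gamma>. {A \<in> S. \<forall>\<Delta>. Black \<Delta> \<in># \<Gamma> \<longrightarrow> Fml A \<notin># \<Delta>}"
  have "card (?M (add_mset (Black \<Delta>') \<Gamma>)) \<le> card (?M (add_mset (Black \<Delta>) \<Gamma>))"
    using assms S by (intro card_mono) (auto simp: extends_def)
  then have "card (?M (add_mset (Black \<Delta>') \<Gamma>)) * Suc (missing S k {#})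
      \<le> card (?M (add_mset (Black \<Delta>) \<Gamma>)) * Suc (missing S k {#})"
    by (rule mult_le_mono1)
  then show ?thesis using assms
    by (simp add: extends_def bounded_add_Black algebra_simps)
qed

text \<open>A strict decrease at a node propagates along the path to the root, so termination can be
  checked locally. The witness \<open>j\<close> is \<open>k\<close> minus the depth of the
  node.\<close>

lemma extends_node_ctxt:
  assumes "node_ctxt F" "bounded S k (F \<Delta>)"
  shows "\<exists>j. bounded S j \<Delta> \<and> (\<forall>\<Delta>'. extends S j \<Delta> \<Delta>' \<longrightarrow> extends S k (F \<Delta>) (F \<Delta>'))"
  using assms
proof (induction arbitrary: k rule: node_ctxt.induct)
  case root
  then show ?case by auto
next
  case (white F \<Gamma>)
  then obtain i where k: "k = Suc i" "bounded S i (F \<Delta>)" "bounded S k \<Gamma>"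
    by (auto simp: bounded_add_White)
  then show ?case using white.IH[of i] extends_White[of i] by blast
next
  case (black F \<Gamma>)
  then obtain i where k: "k = Suc i" "bounded S i (F \<Delta>)" "bounded S k \<Gamma>"
    by (auto simp: bounded_add_Black)
  then show ?case using black.IH[of i] extends_Black[of i] by blast
qed

end

section \<open>The countermodel of a saturated sequent\<close>

definition occurs :: "'p sequent \<Rightarrow> 'p sequent \<Rightarrow> bool" where
  "occurs T \<Delta> \<longleftrightarrow> (\<exists>F. node_ctxt F \<and> F \<Delta> = T)"

lemma occurs_refl: "occurs T T"
  unfolding occurs_def using node_ctxt.root by blast

lemma occurs_White: "occurs T \<Delta> \<Longrightarrow> White \<Theta> \<in># \<Delta> \<Longrightarrow> occurs T \<Theta>"
  unfolding occurs_def by (auto dest!: multi_member_split intro: node_ctxt_White)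

lemma occurs_Black: "occurs T \<Delta> \<Longrightarrow> Black \<Theta> \<in># \<Delta> \<Longrightarrow> occurs T \<Theta>"
  unfolding occurs_def by (auto dest!: multi_member_split intro: node_ctxt_Black)

text \<open>Saturation is relative to derivability: every addition that lowers the measure yields a
  derivable sequent. If all premises of a rule were such additions, the rule would derive
  \<open>T\<close>, against \<open>underivable\<close>.\<close>

locale saturated =
  fixes S :: "'p fml set" and k :: nat and T :: "'p sequent"
  assumes finite_S: "finite S"
    and closed_S: "\<And>A. A \<in> S \<Longrightarrow> subfmls A \<subseteq> S"
    and bounded_T: "bounded S k T"
    and underivable: "\<not> DKt T"
    and stuck: "\<And>F \<Delta> X. node_ctxt F \<Longrightarrow> F \<Delta> = T \<Longrightarrow> extends S k T (F (\<Delta> + X)) \<Longrightarrow> DKt (F (\<Delta> + X))"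
begin

lemma occursE:
  assumes "occurs T \<Delta>"
  obtains F j where "node_ctxt F" "F \<Delta> = T" "bounded S j \<Delta>"
    "\<And>\<Delta>'. extends S j \<Delta> \<Delta>' \<Longrightarrow> extends S k T (F \<Delta>')"
proof -
  obtain F where F: "node_ctxt F" "F \<Delta> = T" using assms unfolding occurs_def by blast
  then obtain j where j: "bounded S j \<Delta>" "\<forall>\<Delta>'. extends S j \<Delta> \<Delta>' \<longrightarrow> extends S k T (F \<Delta>')"
    using extends_node_ctxt[OF finite_S F(1), of k \<Delta>] bounded_T by auto
  show thesis by (rule that[OF F j(1)]) (simp add: j(2))
qed

section \<open>Saturation conditions, one for each deep rule\<close>

lemma sat_id:
  assumes "occurs T \<Delta>" "Fml (Atom a) \<in># \<Delta>"
  shows "Fml (NegAtom a) \<notin># \<Delta>"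
proof -
  obtain F where F: "node_ctxt F" "F \<Delta> = T" using assms(1) unfolding occurs_def by blast
  show ?thesis using DKt_node_id[OF F(1) assms(2)] F(2) underivable by auto
qed

lemma sat_conj:
  assumes "occurs T \<Delta>" "Fml (And A B) \<in># \<Delta>"
  shows "Fml A \<in># \<Delta> \<or> Fml B \<in># \<Delta>"
proof (rule ccontr)
  assume not: "\<not> ?thesis"
  obtain F j where F: "node_ctxt F" "F \<Delta> = T" "bounded S j \<Delta>"
    "\<And>\<Delta>'. extends S j \<Delta> \<Delta>' \<Longrightarrow> extends S k T (F \<Delta>')" using occursE[OF assms(1)] by blast
  have "And A B \<in> S" "A \<in> S" "B \<in> S" "degree A \<le> j" "degree B \<le> j"
    using bounded_FmlD[OF F(3) assms(2)] closed_S[of "And A B"] by (auto dest!: subsetD)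
  then have "DKt (F (\<Delta> + {#Fml A#}))" "DKt (F (\<Delta> + {#Fml B#}))"
    using not extends_add_Fml[OF finite_S F(3)] F(4) stuck[OF F(1,2)] by blast+
  then show False using DKt_node_conj[OF F(1) assms(2)] F(2) underivable by simp
qed

lemma sat_disj:
  assumes "occurs T \<Delta>" "Fml (Or A B) \<in># \<Delta>"
  shows "Fml A \<in># \<Delta> \<and> Fml B \<in># \<Delta>"
proof (rule ccontr)
  assume not: "\<not> ?thesis"
  obtain F j where F: "node_ctxt F" "F \<Delta> = T" "bounded S j \<Delta>"
    "\<And>\<Delta>'. extends S j \<Delta> \<Delta>' \<Longrightarrow> extends S k T (F \<Delta>')" using occursE[OF assms(1)] by blast
  have "A \<in> S" "B \<in> S" "degree A \<le> j" "degree B \<le> j"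
    using bounded_FmlD[OF F(3) assms(2)] closed_S[of "Or A B"] by (auto dest!: subsetD)
  \<comment> \<open>Whichever disjunct is absent accounts for the decrease, so both are tried as the
    new formula.\<close>
  then have "extends S j \<Delta> (\<Delta> + image_mset Fml {#A, B#})"
    using not extends_add_fmls[OF finite_S F(3), of "{#A, B#}" A]
      extends_add_fmls[OF finite_S F(3), of "{#A, B#}" B] by auto
  then have "DKt (F (\<Delta> + {#Fml A, Fml B#}))"
    using F(4) stuck[OF F(1,2), of "{#Fml A, Fml B#}"] by simp
  then show False using DKt_node_disj[OF F(1) assms(2)] F(2) underivable by simp
qed

lemma sat_box:
  assumes "occurs T \<Delta>" "Fml (Box A) \<in># \<Delta>"
  shows "\<exists>\<Theta>. White \<Theta> \<in># \<Delta> \<and> Fml A \<in># \<Theta>"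
proof (rule ccontr)
  assume not: "\<not> ?thesis"
  obtain F j where F: "node_ctxt F" "F \<Delta> = T" "bounded S j \<Delta>"
    "\<And>\<Delta>'. extends S j \<Delta> \<Delta>' \<Longrightarrow> extends S k T (F \<Delta>')" using occursE[OF assms(1)] by blast
  \<comment> \<open>The degree of \<open>Box A\<close> is positive, so the budget \<open>j\<close>
    of the node is a successor and leaves room for a child.\<close>
  obtain i where "A \<in> S" and i: "j = Suc i" "degree A \<le> i"
    using bounded_FmlD[OF F(3) assms(2)] closed_S[of "Box A"] by (auto dest!: subsetD Suc_le_D)
  then have "DKt (F (\<Delta> + {#White {#Fml A#}#}))"
    using not extends_add_White[OF finite_S F(3)[unfolded i]] F(4) stuck[OF F(1,2)] by blast
  then show False using DKt_node_box[OF F(1) assms(2)] F(2) underivable by simp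
qed

lemma sat_bbox:
  assumes "occurs T \<Delta>" "Fml (BBox A) \<in># \<Delta>"
  shows "\<exists>\<Theta>. Black \<Theta> \<in># \<Delta> \<and> Fml A \<in># \<Theta>"
proof (rule ccontr)
  assume not: "\<not> ?thesis"
  obtain F j where F: "node_ctxt F" "F \<Delta> = T" "bounded S j \<Delta>"
    "\<And>\<Delta>'. extends S j \<Delta> \<Delta>' \<Longrightarrow> extends S k T (F \<Delta>')" using occursE[OF assms(1)] by blast
  obtain i where "A \<in> S" and i: "j = Suc i" "degree A \<le> i"
    using bounded_FmlD[OF F(3) assms(2)] closed_S[of "BBox A"] by (auto dest!: subsetD Suc_le_D)
  then have "DKt (F (\<Delta> + {#Black {#Fml A#}#}))"
    using not extends_add_Black[OF finite_S F(3)[unfolded i]] F(4) stuck[OF F(1,2)] by blast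
  then show False using DKt_node_bbox[OF F(1) assms(2)] F(2) underivable by simp
qed

lemma sat_dia1:
  assumes "occurs T \<Delta>" "Fml (Dia A) \<in># \<Delta>" "White \<Theta> \<in># \<Delta>"
  shows "Fml A \<in># \<Theta>"
proof (rule ccontr)
  assume not: "\<not> ?thesis"
  obtain F j where F: "node_ctxt F" "F \<Delta> = T" "bounded S j \<Delta>"
    "\<And>\<Delta>'. extends S j \<Delta> \<Delta>' \<Longrightarrow> extends S k T (F \<Delta>')" using occursE[OF assms(1)] by blast
  obtain \<Gamma> where \<Delta>: "\<Delta> = add_mset (White \<Theta>) \<Gamma>" using assms(3) by (auto dest!: multi_member_split)
  then have dia: "Fml (Dia A) \<in># \<Gamma>" using assms(2) by simp
  obtain i where i: "j = Suc i" "bounded S i \<Theta>" "bounded S (Suc i) \<Gamma>"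
    using F(3) by (auto simp: \<Delta> bounded_add_White)
  have "A \<in> S" "degree A \<le> i"
    using bounded_FmlD[OF F(3) assms(2)] closed_S[of "Dia A"] i(1) by (auto dest!: subsetD)
  then have "extends S j \<Delta> (add_mset (White (\<Theta> + {#Fml A#})) \<Gamma>)"
    unfolding i(1) \<Delta> using not extends_White[OF finite_S i(3)] extends_add_Fml[OF finite_S i(2)]
    by blast
  \<comment> \<open>The node that grows is the child \<open>\<Theta>\<close>, so
    \<open>stuck\<close> is applied to the context prolonged by one level.\<close>
  then have "DKt (F (add_mset (White (\<Theta> + {#Fml A#})) \<Gamma>))"
    using F(4) stuck[OF node_ctxt_White[OF F(1)], of \<Theta> \<Gamma> "{#Fml A#}"] F(2) \<Delta> by simp
  then show False using DKt_node_dia1[OF F(1) dia] F(2) underivable \<Delta> by blast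
qed

lemma sat_bdia1:
  assumes "occurs T \<Delta>" "Fml (BDia A) \<in># \<Delta>" "Black \<Theta> \<in># \<Delta>"
  shows "Fml A \<in># \<Theta>"
proof (rule ccontr)
  assume not: "\<not> ?thesis"
  obtain F j where F: "node_ctxt F" "F \<Delta> = T" "bounded S j \<Delta>"
    "\<And>\<Delta>'. extends S j \<Delta> \<Delta>' \<Longrightarrow> extends S k T (F \<Delta>')" using occursE[OF assms(1)] by blast
  obtain \<Gamma> where \<Delta>: "\<Delta> = add_mset (Black \<Theta>) \<Gamma>" using assms(3) by (auto dest!: multi_member_split)
  then have bdia: "Fml (BDia A) \<in># \<Gamma>" using assms(2) by simp
  obtain i where i: "j = Suc i" "bounded S i \<Theta>" "bounded S (Suc i) \<Gamma>"
    using F(3) by (auto simp: \<Delta> bounded_add_Black)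
  have "A \<in> S" "degree A \<le> i"
    using bounded_FmlD[OF F(3) assms(2)] closed_S[of "BDia A"] i(1) by (auto dest!: subsetD)
  then have "extends S j \<Delta> (add_mset (Black (\<Theta> + {#Fml A#})) \<Gamma>)"
    unfolding i(1) \<Delta> using not extends_Black[OF finite_S i(3)] extends_add_Fml[OF finite_S i(2)]
    by blast
  then have "DKt (F (add_mset (Black (\<Theta> + {#Fml A#})) \<Gamma>))"
    using F(4) stuck[OF node_ctxt_Black[OF F(1)], of \<Theta> \<Gamma> "{#Fml A#}"] F(2) \<Delta> by simp
  then show False using DKt_node_bdia1[OF F(1) bdia] F(2) underivable \<Delta> by blast
qed

lemma sat_dia2:
  assumes "occurs T \<Delta>" "Black \<Theta> \<in># \<Delta>" "Fml (Dia A) \<in># \<Theta>"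
  shows "Fml A \<in># \<Delta>"
proof (rule ccontr)
  assume not: "\<not> ?thesis"
  obtain F j where F: "node_ctxt F" "F \<Delta> = T" "bounded S j \<Delta>"
    "\<And>\<Delta>'. extends S j \<Delta> \<Delta>' \<Longrightarrow> extends S k T (F \<Delta>')" using occursE[OF assms(1)] by blast
  obtain i where i: "j = Suc i" "bounded S i \<Theta>"
    using F(3) assms(2) by (auto simp: bounded_add_Black dest!: multi_member_split)
  have "A \<in> S" "degree A \<le> j"
    using bounded_FmlD[OF i(2) assms(3)] closed_S[of "Dia A"] i(1) by (auto dest!: subsetD)
  then have "DKt (F (\<Delta> + {#Fml A#}))"
    using not extends_add_Fml[OF finite_S F(3)] F(4) stuck[OF F(1,2)] by blast
  then show False using DKt_node_dia2[OF F(1) assms(2,3)] F(2) underivable by simp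
qed

lemma sat_bdia2:
  assumes "occurs T \<Delta>" "White \<Theta> \<in># \<Delta>" "Fml (BDia A) \<in># \<Theta>"
  shows "Fml A \<in># \<Delta>"
proof (rule ccontr)
  assume not: "\<not> ?thesis"
  obtain F j where F: "node_ctxt F" "F \<Delta> = T" "bounded S j \<Delta>"
    "\<And>\<Delta>'. extends S j \<Delta> \<Delta>' \<Longrightarrow> extends S k T (F \<Delta>')" using occursE[OF assms(1)] by blast
  obtain i where i: "j = Suc i" "bounded S i \<Theta>"
    using F(3) assms(2) by (auto simp: bounded_add_White dest!: multi_member_split)
  have "A \<in> S" "degree A \<le> j"
    using bounded_FmlD[OF i(2) assms(3)] closed_S[of "BDia A"] i(1) by (auto dest!: subsetD)
  then have "DKt (F (\<Delta> + {#Fml A#}))"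
    using not extends_add_Fml[OF finite_S F(3)] F(4) stuck[OF F(1,2)] by blast
  then show False using DKt_node_bdia2[OF F(1) assms(2,3)] F(2) underivable by simp
qed

text \<open>Nodes with equal content are one world: saturation makes their positions irrelevant.\<close>

definition acc :: "'p sequent \<Rightarrow> 'p sequent \<Rightarrow> bool" where
  "acc \<Delta> \<Delta>' \<longleftrightarrow> occurs T \<Delta> \<and> occurs T \<Delta>' \<and> (White \<Delta>' \<in># \<Delta> \<or> Black \<Delta> \<in># \<Delta>')"

text \<open>An atom is true exactly where its negation is present: negated atoms of a node fail by
  definition, and plain atoms fail by \<open>sat_id\<close>.\<close>

definition val :: "'p sequent \<Rightarrow> 'p \<Rightarrow> bool" where
  "val \<Delta> a \<longleftrightarrow> Fml (NegAtom a) \<in># \<Delta>"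

text \<open>Box formulae fail because saturation provides a child refuting their body. For
  \<open>Dia A\<close>, a successor is either a white child, which contains \<open>A\<close> by
  \<open>sat_dia1\<close>, or the parent of a black child, which contains \<open>A\<close> by
  \<open>sat_dia2\<close>; \<open>BDia\<close> is dual.\<close>

lemma refutes_fml: "occurs T \<Delta> \<Longrightarrow> Fml A \<in># \<Delta> \<Longrightarrow> \<not> holds acc val A \<Delta>"
proof (induction A arbitrary: \<Delta>)
  case (Atom a)
  then show ?case using sat_id[of \<Delta> a] by (simp add: val_def)
next
  case (NegAtom a)
  then show ?case by (simp add: val_def)
next
  case (Or A B)
  then show ?case using sat_disj[of \<Delta> A B] by simp
next
  case (And A B)
  then show ?case using sat_conj[of \<Delta> A B] by auto
next
  case (Box A)
  then obtain \<Theta> where \<Theta>: "White \<Theta> \<in># \<Delta>" "Fml A \<in># \<Theta>" using sat_box by blast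
  then have "acc \<Delta> \<Theta>" "occurs T \<Theta>" using Box.prems occurs_White by (auto simp: acc_def)
  then show ?case using Box.IH \<Theta>(2) by auto
next
  case (BBox A)
  then obtain \<Theta> where \<Theta>: "Black \<Theta> \<in># \<Delta>" "Fml A \<in># \<Theta>" using sat_bbox by blast
  then have "acc \<Theta> \<Delta>" "occurs T \<Theta>" using BBox.prems occurs_Black by (auto simp: acc_def)
  then show ?case using BBox.IH \<Theta>(2) by auto
next
  case (Dia A)
  have "Fml A \<in># \<Theta>" "occurs T \<Theta>" if "acc \<Delta> \<Theta>" for \<Theta>
    using that Dia.prems sat_dia1 sat_dia2 unfolding acc_def by blast+
  then show ?case using Dia.IH by auto
next
  case (BDia A)
  have "Fml A \<in># \<Theta>" "occurs T \<Theta>" if "acc \<Theta> \<Delta>" for \<Theta>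
    using that BDia.prems sat_bdia1 sat_bdia2 unfolding acc_def by blast+
  then show ?case using BDia.IH by auto
qed

text \<open>A structure fails at its parent because its content is itself an accessible world, where
  by induction every item fails.\<close>

lemma refutes_item: "occurs T \<Delta> \<Longrightarrow> x \<in># \<Delta> \<Longrightarrow> \<not> holds_item acc val x \<Delta>"
proof (induction x arbitrary: \<Delta>)
  case (Fml A)
  then show ?case using refutes_fml by simp
next
  case (White \<Gamma>)
  then have "occurs T \<Gamma>" "acc \<Delta> \<Gamma>" using occurs_White by (auto simp: acc_def)
  with White.IH show ?case by (auto simp: holds_seq_def)
next
  case (Black \<Gamma>)
  then have "occurs T \<Gamma>" "acc \<Gamma> \<Delta>" using occurs_Black by (auto simp: acc_def)
  with Black.IH show ?case by (auto simp: holds_seq_def)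
qed

lemma refutes_self: "\<not> holds_seq acc val T T"
  using refutes_item occurs_refl by (auto simp: holds_seq_def)

end

section \<open>Completeness of the deep calculus and the equivalence\<close>

lemma DKt_complete_bounded:
  fixes T :: "'p sequent"
  assumes "finite S" "\<And>A. A \<in> S \<Longrightarrow> subfmls A \<subseteq> S"
  shows "bounded S k T \<Longrightarrow> \<not> DKt T \<Longrightarrow> \<exists>R V (w :: 'p sequent). \<not> holds_seq R V T w"
proof (induction "missing S k T" arbitrary: T rule: less_induct)
  case less
  show ?case
  \<comment> \<open>Either some measure-lowering addition remains underivable, and its countermodel
    from the induction hypothesis also refutes \<open>T\<close> by monotonicity, or \<open>T\<close>
    is saturated and refutes itself.\<close>
  proof (cases "\<exists>F \<Delta> X. node_ctxt F \<and> F \<Delta> = T \<and> extends S k T (F (\<Delta> + X)) \<and> \<not> DKt (F (\<Delta> + X))")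
    case True
    then obtain F \<Delta> X where F: "node_ctxt F" "F \<Delta> = T" "extends S k T (F (\<Delta> + X))"
      "\<not> DKt (F (\<Delta> + X))" by blast
    then obtain R V and w :: "'p sequent" where "\<not> holds_seq R V (F (\<Delta> + X)) w"
      using less.hyps[of "F (\<Delta> + X)"] unfolding extends_def by blast
    then have "\<not> holds_seq R V T w"
      using node_ctxt_holds_mono[OF F(1), of R V \<Delta> "\<Delta> + X"] F(2) by auto
    then show ?thesis by blast
  next
    case False
    then interpret saturated S k T
      using assms less.prems by unfold_locales blast+
    show ?thesis using refutes_self by blast
  qed
qed

text \<open>Only models whose worlds are sequents are required, since the countermodels are built
  from nodes; \<open>SKt_sound\<close>, holding for any type of worlds, is instantiated to
  these.\<close>

lemma DKt_complete:
  fixes \<Gamma> :: "'p sequent"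
  assumes "\<And>R V (w :: 'p sequent). holds_seq R V \<Gamma> w"
  shows "DKt \<Gamma>"
proof -
  obtain S k where "finite S" "\<And>A. A \<in> S \<Longrightarrow> subfmls A \<subseteq> S" "bounded S k \<Gamma>"
    by (rule ex_bounded[of \<Gamma>]) blast
  with assms show ?thesis using DKt_complete_bounded[of S k \<Gamma>] by blast
qed

theorem theorem4p6:
  fixes \<Gamma> :: "'p sequent"
  shows "SKt \<Gamma> \<longleftrightarrow> DKt \<Gamma>"
  by (auto intro: DKt_complete SKt_sound DKt_imp_SKt)

end
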